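(* For every Ferrers shape $F_\lambda$, the number of $\Gamma$-free $0$-$1$ fillings of $F_\lambda$ equals the number of lonesum $0$-$1$ fillings of $F_\lambda$.
   Context: Given a partition $\lambda=(\lambda_1\ge\lambda_2\ge\dots\ge\lambda_n\geq 1)$, the Ferrers shape $F_\lambda$ is the arrangement of cells justified to the left and to the bottom with $n$ rows, where the $i$-th row from the bottom has $\lambda_i$ cells. A $0$-$1$ filling of $F_\lambda$ (Ferrers diagram) assigns $0$ or $1$ to each cell of $F_\lambda$. A filling is $\Gamma$-free if there are no three cells of the shape, all containing $1$, such that two of them are in the same row and the third lies in the same column as the left one of these two, strictly below it (rows and columns involved need not be adjacent). A filling is lonesum if there are no two (not necessarily adjacent) rows and two (not necessarily adjacent) columns whose four intersection cells all belong to the shape and whose entries form $\begin{pmatrix}1&0\\0&1\end{pmatrix}$ or $\begin{pmatrix}0&1\\1&0\end{pmatrix}$. *)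

theory Defs
  imports Main "HOL-Library.FuncSet"
begin

definition is_partition :: "nat list \<Rightarrow> bool" where
  "is_partition lam \<longleftrightarrow> sorted_wrt (\<ge>) lam \<and> (\<forall>x \<in> set lam. x \<ge> 1)"

text \<open>A cell is a pair (row, column), both counted from 0: rows from the bottom
  upwards, columns from left to right. In particular a larger row index means a
  higher row.\<close>

definition ferrers_shape :: "nat list \<Rightarrow> (nat \<times> nat) set" where
  "ferrers_shape lam = {(i, j). i < length lam \<and> j < lam ! i}"

text \<open>Fillings are extensional (undefined outside the shape), so that distinct
  elements of this set are distinct assignments of entries to the cells.\<close>

definition fillings :: "(nat \<times> nat) set \<Rightarrow> (nat \<times> nat \<Rightarrow> nat) set" where
  "fillings F = (F \<rightarrow>\<^sub>E {0, 1})"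

definition gamma_free :: "(nat \<times> nat) set \<Rightarrow> (nat \<times> nat \<Rightarrow> nat) \<Rightarrow> bool" where
  "gamma_free F f \<longleftrightarrow>
     \<not> (\<exists>r r' c c'. r' < r \<and> c < c' \<and>
          (r, c) \<in> F \<and> (r, c') \<in> F \<and> (r', c) \<in> F \<and>
          f (r, c) = 1 \<and> f (r, c') = 1 \<and> f (r', c) = 1)"

definition lonesum :: "(nat \<times> nat) set \<Rightarrow> (nat \<times> nat \<Rightarrow> nat) \<Rightarrow> bool" where
  "lonesum F f \<longleftrightarrow>
     \<not> (\<exists>r r' c c'. r' < r \<and> c < c' \<and>
          (r, c) \<in> F \<and> (r, c') \<in> F \<and> (r', c) \<in> F \<and> (r', c') \<in> F \<and>
          ((f (r, c) = 1 \<and> f (r, c') = 0 \<and> f (r', c) = 0 \<and> f (r', c') = 1) \<or>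
           (f (r, c) = 0 \<and> f (r, c') = 1 \<and> f (r', c) = 1 \<and> f (r', c') = 0)))"

end

theory Submission
  imports Defs
begin

text \<open>
  Both counts obey the same recursion on the number of rows, obtained by removing the top
  (shortest) row. Let \<open>M\<close> be the set of columns of the top row; each of these columns has
  full height.

  In a \<open>\<Gamma>\<close>-free filling with \<open>K \<subseteq> M\<close> the set of columns where the top row has a 1, every
  column of \<open>K\<close> except the rightmost one is the corner of a potential \<open>\<Gamma>\<close>, hence is empty below
  the top row and may be deleted. Conversely such empty columns impose nothing, so the fillings
  with top row \<open>K\<close> are the \<open>\<Gamma>\<close>-free fillings of the lower rows with the columns
  \<open>K - {Max K}\<close> deleted (\<open>gamma_recursion\<close>).

  In a lonesum filling the columns of \<open>M\<close>, cut below the top row, form a chain under inclusion.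
  A set \<open>S \<subseteq> M\<close> can be the set of ones of the top row iff every column of \<open>S\<close> contains every
  column of \<open>M - S\<close>, that is, iff \<open>S\<close> is an upper set of the chain up to an arbitrary choice
  among the columns that tie at the threshold. Recording only the tied columns chosen at the
  threshold turns \<open>S\<close> into a set \<open>K\<close> of equal columns, and every set of equal columns arises
  exactly once (\<open>card_threshold_sets\<close>). Fillings in which the columns of \<open>K\<close> agree are
  determined by one of them, so again the columns \<open>K - {Max K}\<close> may be deleted
  (\<open>lonesum_recursion\<close>).

  Hence both numbers for the shape are the sum over all \<open>K \<subseteq> M\<close> of the corresponding numbers
  for the lower rows without the columns \<open>K - {Max K}\<close>, and they agree by induction. Deleting
  columns leaves shapes that are no longer left-justified; to avoid renumbering, the induction
  runs over shapes with \<open>n\<close> rows whose column sets \<open>C i\<close> are arbitrary finite sets of naturals,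
  decreasing in \<open>i\<close>. A filling is represented by the set of cells that carry a 1.
\<close>

section \<open>Fillings as sets of cells\<close>

definition gamma_free_set :: "(nat \<times> nat) set \<Rightarrow> bool" where
  "gamma_free_set A \<longleftrightarrow>
     (\<forall>r r' c c'. r' < r \<and> c < c' \<and> (r, c) \<in> A \<and> (r, c') \<in> A \<longrightarrow> (r', c) \<notin> A)"

text \<open>The two forbidden patterns are exchanged by swapping the two columns, so a single
  condition on ordered pairs of distinct columns covers both. Only the upper cell without a 1 is
  tested against the shape: the lower one lies below a cell that carries a 1, and the shape is
  closed downwards.\<close>

definition lonesum_set :: "(nat \<Rightarrow> nat set) \<Rightarrow> (nat \<times> nat) set \<Rightarrow> bool" where
  "lonesum_set C A \<longleftrightarrow>
     (\<forall>r r' c c'. r' < r \<and> c' \<in> C r \<and> (r, c) \<in> A \<and> (r, c') \<notin> A \<and> (r', c') \<in> A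
        \<longrightarrow> (r', c) \<in> A)"

lemma card_fillings_eq_card_subsets:
  assumes "\<And>f. f \<in> fillings F \<Longrightarrow> P f \<longleftrightarrow> Q {x \<in> F. f x = 1}"
  shows "card {f \<in> fillings F. P f} = card {A \<in> Pow F. Q A}"
proof -
  let ?ones = "\<lambda>f. {x \<in> F. f x = (1::nat)}"
  let ?ind = "\<lambda>A. restrict (\<lambda>x. if x \<in> A then 1 else (0::nat)) F"
  have ind: "?ind A \<in> fillings F" "?ones (?ind A) = A" if "A \<subseteq> F" for A
    using that by (auto simp: fillings_def)
  have ones: "?ind (?ones f) = f" if "f \<in> fillings F" for f
  proof
    fix x
    have f: "f \<in> F \<rightarrow>\<^sub>E {0, 1}" using that by (simp add: fillings_def)
    show "?ind (?ones f) x = f x"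
      using PiE_mem[OF f, of x] PiE_arb[OF f, of x] by (cases "x \<in> F") auto
  qed
  have "bij_betw ?ones {f \<in> fillings F. P f} {A \<in> Pow F. Q A}"
  proof (rule bij_betw_byWitness[where f' = ?ind])
    show "\<forall>f\<in>{f \<in> fillings F. P f}. ?ind (?ones f) = f"
      using ones by blast
    show "\<forall>A\<in>{A \<in> Pow F. Q A}. ?ones (?ind A) = A"
      using ind(2) by blast
    show "?ones ` {f \<in> fillings F. P f} \<subseteq> {A \<in> Pow F. Q A}"
      using assms by auto
    show "?ind ` {A \<in> Pow F. Q A} \<subseteq> {f \<in> fillings F. P f}"
    proof (rule image_subsetI)
      fix A assume "A \<in> {A \<in> Pow F. Q A}"
      then have A: "A \<subseteq> F" "Q A" by auto
      then have "P (?ind A)" using assms[OF ind(1)[OF A(1)]] ind(2)[OF A(1)] by simp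
      then show "?ind A \<in> {f \<in> fillings F. P f}" using ind(1)[OF A(1)] by blast
    qed
  qed
  then show ?thesis by (rule bij_betw_same_card)
qed

lemma gamma_free_iff_gamma_free_set: "gamma_free F f \<longleftrightarrow> gamma_free_set {x \<in> F. f x = 1}"
  unfolding gamma_free_def gamma_free_set_def by auto

lemma lonesum_iff_lonesum_set:
  assumes f: "f \<in> fillings (Sigma {..<n} C)" and C: "antimono C"
  shows "lonesum (Sigma {..<n} C) f \<longleftrightarrow>
    lonesum_set C {x \<in> Sigma {..<n} C. f x = 1}" (is "_ \<longleftrightarrow> lonesum_set C ?A")
proof
  let ?F = "Sigma {..<n} C"
  have below: "(r', c) \<in> ?F" if "r' < r" "(r, c) \<in> ?F" for r r' c
    using that C[THEN antimonoD, of r' r] by auto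
  have f01: "f x = 0" if "x \<in> ?F" "f x \<noteq> 1" for x
    using f that by (auto simp: fillings_def PiE_def Pi_def)
  {
    assume *: "lonesum ?F f"
    show "lonesum_set C ?A"
      unfolding lonesum_set_def
    proof (intro allI impI)
      fix r r' c c'
      assume h: "r' < r \<and> c' \<in> C r \<and> (r, c) \<in> ?A \<and> (r, c') \<notin> ?A \<and> (r', c') \<in> ?A"
      then have F: "(r, c) \<in> ?F" "(r, c') \<in> ?F" by auto
      then have F': "(r', c) \<in> ?F" "(r', c') \<in> ?F" using below h by blast+
      show "(r', c) \<in> ?A"
      proof (rule ccontr)
        assume "(r', c) \<notin> ?A"
        then have v: "f (r, c) = 1" "f (r, c') = 0" "f (r', c) = 0" "f (r', c') = 1"
          using h F F' f01 by auto
        then have "c \<noteq> c'" by auto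
        then consider "c < c'" | "c' < c" by linarith
        then show False
        proof cases
          case 1
          then show False using * h v F F' unfolding lonesum_def by blast
        next
          case 2
          then show False using * h v F F' unfolding lonesum_def by blast
        qed
      qed
    qed
  }
  {
    assume *: "lonesum_set C ?A"
    have no: False
      if "r' < r" "(r, c) \<in> ?F" "(r, c') \<in> ?F" "(r', c') \<in> ?F"
        "f (r, c) = 1" "f (r, c') = 0" "f (r', c) = 0" "f (r', c') = 1" for r r' c c'
    proof -
      have "(r', c) \<in> ?A"
        using that by (intro *[unfolded lonesum_set_def, rule_format, of r' r c' c]) auto
      then show False using that by simp
    qed
    show "lonesum ?F f"
      unfolding lonesum_def using no by blast
  }
qed

section \<open>Splitting off the top row\<close>

lemma card_filter_pairs_swap:
  assumes "finite X" "finite Y"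
  shows "(\<Sum>x\<in>X. card {y \<in> Y. P x y}) = (\<Sum>y\<in>Y. card {x \<in> X. P x y})"
proof -
  have "(\<Sum>x\<in>X. card {y \<in> Y. P x y}) = (\<Sum>x\<in>X. \<Sum>y\<in>Y. if P x y then 1 else 0)"
    using assms by (simp add: sum.If_cases Int_def)
  also have "\<dots> = (\<Sum>y\<in>Y. \<Sum>x\<in>X. if P x y then 1 else 0)"
    by (rule sum.swap)
  also have "\<dots> = (\<Sum>y\<in>Y. card {x \<in> X. P x y})"
    using assms by (simp add: sum.If_cases Int_def)
  finally show ?thesis .
qed

lemma card_subsets_by_top_row:
  fixes C :: "nat \<Rightarrow> nat set"
  assumes fin: "\<And>i. finite (C i)"
  shows "card {A \<in> Pow (Sigma {..<Suc n} C). P A} =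
    (\<Sum>S\<in>Pow (C n). card {B \<in> Pow (Sigma {..<n} C). P (B \<union> {n} \<times> S)})"
proof -
  let ?D = "SIGMA S:Pow (C n). {B \<in> Pow (Sigma {..<n} C). P (B \<union> {n} \<times> S)}"
  let ?split = "\<lambda>A. (A `` {n}, A \<inter> Sigma {..<n} C)"
  have join: "A \<inter> Sigma {..<n} C \<union> {n} \<times> (A `` {n}) = A" if "A \<subseteq> Sigma {..<Suc n} C" for A
    using that by (auto simp: less_Suc_eq)
  have split: "?split (B \<union> {n} \<times> S) = (S, B)" if "B \<subseteq> Sigma {..<n} C" for B S
    using that by auto
  have "bij_betw ?split {A \<in> Pow (Sigma {..<Suc n} C). P A} ?D"
  proof (rule bij_betw_byWitness[where f' = "\<lambda>(S, B). B \<union> {n} \<times> S"])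
    show "\<forall>A\<in>{A \<in> Pow (Sigma {..<Suc n} C). P A}. (\<lambda>(S, B). B \<union> {n} \<times> S) (?split A) = A"
      using join by simp
    show "\<forall>x\<in>?D. ?split ((\<lambda>(S, B). B \<union> {n} \<times> S) x) = x"
      using split by auto
    show "?split ` {A \<in> Pow (Sigma {..<Suc n} C). P A} \<subseteq> ?D"
    proof (rule image_subsetI)
      fix A assume A: "A \<in> {A \<in> Pow (Sigma {..<Suc n} C). P A}"
      then have "A `` {n} \<subseteq> C n" by auto
      then show "?split A \<in> ?D" using A join[of A] by simp
    qed
    show "(\<lambda>(S, B). B \<union> {n} \<times> S) ` ?D \<subseteq> {A \<in> Pow (Sigma {..<Suc n} C). P A}"
    proof (rule image_subsetI)
      fix x assume "x \<in> ?D"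
      then obtain S B where x: "x = (S, B)" "S \<subseteq> C n" "B \<subseteq> Sigma {..<n} C" "P (B \<union> {n} \<times> S)"
        by blast
      have "Sigma {..<n} C \<subseteq> Sigma {..<Suc n} C" by (intro Sigma_mono) auto
      moreover have "{n} \<times> S \<subseteq> Sigma {..<Suc n} C" using x(2) by auto
      ultimately have "B \<union> {n} \<times> S \<subseteq> Sigma {..<Suc n} C" using x(3) by blast
      then show "(\<lambda>(S, B). B \<union> {n} \<times> S) x \<in> {A \<in> Pow (Sigma {..<Suc n} C). P A}"
        using x by simp
    qed
  qed
  then have "card {A \<in> Pow (Sigma {..<Suc n} C). P A} = card ?D"
    by (rule bij_betw_same_card)
  also have "\<dots> = (\<Sum>S\<in>Pow (C n). card {B \<in> Pow (Sigma {..<n} C). P (B \<union> {n} \<times> S)})"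
    using fin by (intro card_SigmaI) auto
  finally show ?thesis .
qed

section \<open>The recursion for \<open>\<Gamma>\<close>-free fillings\<close>

lemma gamma_free_set_add_top_row:
  assumes B: "B \<subseteq> Sigma {..<n} C" and S: "finite S"
  shows "gamma_free_set (B \<union> {n} \<times> S) \<longleftrightarrow>
    gamma_free_set B \<and> (\<forall>c\<in>S - {Max S}. \<forall>i. (i, c) \<notin> B)"
proof
  assume *: "gamma_free_set (B \<union> {n} \<times> S)"
  have "gamma_free_set B"
    using * unfolding gamma_free_set_def by blast
  moreover have "(i, c) \<notin> B" if c: "c \<in> S - {Max S}" for c i
  proof
    assume i: "(i, c) \<in> B"
    have "c < Max S" "Max S \<in> S"
      using c Max_in[OF S] Max_ge[OF S, of c] by fastforce+
    moreover have "i < n" using i B by auto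
    ultimately show False
      using * c i unfolding gamma_free_set_def by blast
  qed
  ultimately show "gamma_free_set B \<and> (\<forall>c\<in>S - {Max S}. \<forall>i. (i, c) \<notin> B)"
    by blast
next
  assume *: "gamma_free_set B \<and> (\<forall>c\<in>S - {Max S}. \<forall>i. (i, c) \<notin> B)"
  show "gamma_free_set (B \<union> {n} \<times> S)"
    unfolding gamma_free_set_def
  proof (intro allI impI notI)
    fix r r' c c'
    assume h: "r' < r \<and> c < c' \<and> (r, c) \<in> B \<union> {n} \<times> S \<and> (r, c') \<in> B \<union> {n} \<times> S"
      and h': "(r', c) \<in> B \<union> {n} \<times> S"
    have bound: "i < n" if "(i, j) \<in> B" for i j
      using B that by auto
    have "r \<le> n" using h bound by force
    then have r': "(r', c) \<in> B" using h h' by auto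
    show False
    proof (cases "r = n")
      case True
      then have cc: "c \<in> S" "c' \<in> S" using h bound by auto
      then have "c' \<le> Max S" using S by simp
      then have "c \<in> S - {Max S}" using cc h by auto
      then show False using * r' by blast
    next
      case False
      then have "(r, c) \<in> B" "(r, c') \<in> B" using h by auto
      then show False using * h r' unfolding gamma_free_set_def by blast
    qed
  qed
qed

lemma gamma_recursion:
  assumes fin: "\<And>i. finite (C i)"
  shows "card {A \<in> Pow (Sigma {..<Suc n} C). gamma_free_set A} =
    (\<Sum>K\<in>Pow (C n). card {B \<in> Pow (SIGMA i:{..<n}. C i - (K - {Max K})). gamma_free_set B})"
  unfolding card_subsets_by_top_row[OF fin]
proof (rule sum.cong[OF refl])
  fix K assume "K \<in> Pow (C n)"
  then have K: "finite K" using fin finite_subset by auto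
  have "B \<subseteq> (SIGMA i:{..<n}. C i - (K - {Max K})) \<longleftrightarrow>
      B \<subseteq> Sigma {..<n} C \<and> (\<forall>c\<in>K - {Max K}. \<forall>i. (i, c) \<notin> B)" for B
    by blast
  then have "{B \<in> Pow (Sigma {..<n} C). gamma_free_set (B \<union> {n} \<times> K)} =
    {B \<in> Pow (SIGMA i:{..<n}. C i - (K - {Max K})). gamma_free_set B}"
    using gamma_free_set_add_top_row[OF _ K] by (intro Collect_cong) (metis PowD PowI)
  then show "card {B \<in> Pow (Sigma {..<n} C). gamma_free_set (B \<union> {n} \<times> K)} =
    card {B \<in> Pow (SIGMA i:{..<n}. C i - (K - {Max K})). gamma_free_set B}"
    by simp
qed

section \<open>The recursion for lonesum fillings\<close>

text \<open>Upper sets with arbitrary tie-breaking at the threshold correspond to subsets of level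
  sets: send \<open>S\<close> to its elements of minimal value, and send \<open>K\<close> to \<open>K\<close> together with everything
  of larger value. The empty set corresponds to itself.\<close>

lemma card_threshold_sets:
  fixes v :: "'a \<Rightarrow> nat"
  assumes M: "finite M"
  shows "card {S \<in> Pow M. \<forall>c\<in>S. \<forall>c'\<in>M - S. v c' \<le> v c} =
    card {K \<in> Pow M. \<forall>c\<in>K. \<forall>c'\<in>K. v c = v c'}" (is "card ?U = card ?L")
proof (rule bij_betw_same_card)
  let ?low = "\<lambda>S. {c \<in> S. \<forall>d\<in>S. v c \<le> v d}"
  let ?up = "\<lambda>K. K \<union> {c \<in> M. \<exists>k\<in>K. v k < v c}"
  show "bij_betw ?low ?U ?L"
  proof (rule bij_betw_byWitness[where f' = ?up])
    show "\<forall>S\<in>?U. ?up (?low S) = S"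
    proof
      fix S assume S: "S \<in> ?U"
      show "?up (?low S) = S"
      proof
        show "?up (?low S) \<subseteq> S" using S by force
        show "S \<subseteq> ?up (?low S)"
        proof
          fix c assume c: "c \<in> S"
          have "finite S" using S M finite_subset by auto
          then obtain k where k: "k \<in> S" "\<forall>d\<in>S. v k \<le> v d"
            using c by (metis emptyE arg_min_if_finite(1) arg_min_least)
          have kl: "k \<in> ?low S" using k by blast
          show "c \<in> ?up (?low S)"
          proof (cases "v c = v k")
            case True
            then show ?thesis using k c by simp
          next
            case False
            then have "v k < v c" using k c by (simp add: less_le)
            then show ?thesis using kl c S by blast
          qed
        qed
      qed
    qed
    show "\<forall>K\<in>?L. ?low (?up K) = K"
    proof
      fix K assume K: "K \<in> ?L"
      show "?low (?up K) = K"
      proof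
        show "?low (?up K) \<subseteq> K" by force
        show "K \<subseteq> ?low (?up K)"
        proof
          fix c assume c: "c \<in> K"
          have "v c \<le> v d" if d: "d \<in> ?up K" for d
          proof (cases "d \<in> K")
            case True
            then have "v c = v d" using K c by blast
            then show ?thesis by simp
          next
            case False
            then obtain k where "k \<in> K" "v k < v d" using d by blast
            moreover have "v c = v k" using K c \<open>k \<in> K\<close> by blast
            ultimately show ?thesis by simp
          qed
          then show "c \<in> ?low (?up K)" using c by blast
        qed
      qed
    qed
    show "?low ` ?U \<subseteq> ?L"
      by (auto intro: antisym)
    show "?up ` ?L \<subseteq> ?U"
    proof (rule image_subsetI)
      fix K assume K: "K \<in> ?L"
      have "v c' \<le> v c" if c: "c \<in> ?up K" and c': "c' \<in> M - ?up K" for c c'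
      proof -
        have "v c' \<le> v k" if "k \<in> K" for k
          using c' that by (auto simp: not_less)
        then show ?thesis using c by force
      qed
      then show "?up K \<in> ?U" using K by blast
    qed
  qed
qed

lemma lonesum_set_add_top_row:
  assumes B: "B \<subseteq> Sigma {..<n} C"
  shows "lonesum_set C (B \<union> {n} \<times> S) \<longleftrightarrow>
    lonesum_set C B \<and> (\<forall>c\<in>S. \<forall>c'\<in>C n - S. \<forall>i. (i, c') \<in> B \<longrightarrow> (i, c) \<in> B)"
proof -
  have bound: "i < n" if "(i, j) \<in> B" for i j
    using B that by auto
  show ?thesis
  proof
    assume *: "lonesum_set C (B \<union> {n} \<times> S)"
    have "lonesum_set C B"
      unfolding lonesum_set_def
    proof (intro allI impI)
      fix r r' c c'
      assume h: "r' < r \<and> c' \<in> C r \<and> (r, c) \<in> B \<and> (r, c') \<notin> B \<and> (r', c') \<in> B"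
      then have "r < n" using bound by blast
      then have "(r', c) \<in> B \<union> {n} \<times> S"
        using h by (intro *[unfolded lonesum_set_def, rule_format, of r' r c' c]) auto
      then show "(r', c) \<in> B" using \<open>r < n\<close> h by auto
    qed
    moreover have "(i, c) \<in> B" if "c \<in> S" "c' \<in> C n - S" "(i, c') \<in> B" for c c' i
    proof -
      have "i < n" using that bound by blast
      then have "(i, c) \<in> B \<union> {n} \<times> S"
        using that bound by (intro *[unfolded lonesum_set_def, rule_format, of i n c' c]) auto
      then show ?thesis using \<open>i < n\<close> by auto
    qed
    ultimately show "lonesum_set C B \<and> (\<forall>c\<in>S. \<forall>c'\<in>C n - S. \<forall>i. (i, c') \<in> B \<longrightarrow> (i, c) \<in> B)"
      by blast
  next
    assume *: "lonesum_set C B \<and> (\<forall>c\<in>S. \<forall>c'\<in>C n - S. \<forall>i. (i, c') \<in> B \<longrightarrow> (i, c) \<in> B)"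
    show "lonesum_set C (B \<union> {n} \<times> S)"
      unfolding lonesum_set_def
    proof (intro allI impI)
      fix r r' c c'
      assume h: "r' < r \<and> c' \<in> C r \<and> (r, c) \<in> B \<union> {n} \<times> S \<and> (r, c') \<notin> B \<union> {n} \<times> S
        \<and> (r', c') \<in> B \<union> {n} \<times> S"
      have "r \<le> n" using h bound by force
      then have r': "(r', c') \<in> B" using h by auto
      show "(r', c) \<in> B \<union> {n} \<times> S"
      proof (cases "r = n")
        case True
        then have "c \<in> S" "c' \<in> C n - S" using h bound by auto
        then show ?thesis using * r' by blast
      next
        case False
        then have "(r, c) \<in> B" "(r, c') \<notin> B" using h by auto
        then show ?thesis using * h r' unfolding lonesum_set_def by blast
      qed
    qed
  qed
qed

text \<open>Two columns that are both present in all rows cannot be incomparable: a row where only the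
  first has a 1 and a row where only the second has one would form a forbidden pattern, whichever
  of the two rows is higher.\<close>

lemma lonesum_columns_chain:
  assumes ls: "lonesum_set C B" and B: "B \<subseteq> Sigma {..<n} C"
    and full: "\<And>i. i < n \<Longrightarrow> c \<in> C i" "\<And>i. i < n \<Longrightarrow> c' \<in> C i"
  shows "{i. (i, c) \<in> B} \<subseteq> {i. (i, c') \<in> B} \<or> {i. (i, c') \<in> B} \<subseteq> {i. (i, c) \<in> B}"
proof (rule ccontr)
  assume "\<not> ?thesis"
  then obtain i j where ij: "(i, c) \<in> B" "(i, c') \<notin> B" "(j, c') \<in> B" "(j, c) \<notin> B"
    by blast
  then have n: "i < n" "j < n" using B by auto
  have "i \<noteq> j" using ij by auto
  then consider "i < j" | "j < i" by linarith
  then show False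
  proof cases
    case 1
    then show False using ls ij full n unfolding lonesum_set_def by blast
  next
    case 2
    then show False using ls ij full n unfolding lonesum_set_def by blast
  qed
qed

text \<open>Because the columns form a chain, inclusion of columns is comparison of the numbers of their
  ones, which makes \<open>card_threshold_sets\<close> applicable.\<close>

lemma card_admissible_top_rows:
  assumes ls: "lonesum_set C B" and B: "B \<subseteq> Sigma {..<n} C"
    and fin: "finite (C n)" and C: "antimono C"
  shows "card {S \<in> Pow (C n). \<forall>c\<in>S. \<forall>c'\<in>C n - S. \<forall>i. (i, c') \<in> B \<longrightarrow> (i, c) \<in> B} =
    card {K \<in> Pow (C n). \<forall>c\<in>K. \<forall>c'\<in>K. \<forall>i. (i, c) \<in> B \<longleftrightarrow> (i, c') \<in> B}"
proof -
  let ?col = "\<lambda>c. {i. (i, c) \<in> B}"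
  have fincol: "finite (?col c)" for c
    by (rule finite_subset[of _ "{..<n}"]) (use B in auto)
  have full: "c \<in> C i" if "c \<in> C n" "i < n" for c i
    using that C[THEN antimonoD, of i n] by auto
  have chain: "?col c \<subseteq> ?col c' \<or> ?col c' \<subseteq> ?col c" if "c \<in> C n" "c' \<in> C n" for c c'
    using lonesum_columns_chain[OF ls B] full that by blast
  have le: "(\<forall>i. (i, c') \<in> B \<longrightarrow> (i, c) \<in> B) \<longleftrightarrow> card (?col c') \<le> card (?col c)"
    if "c \<in> C n" "c' \<in> C n" for c c'
  proof
    assume "\<forall>i. (i, c') \<in> B \<longrightarrow> (i, c) \<in> B"
    then show "card (?col c') \<le> card (?col c)"
      by (intro card_mono fincol) auto
  next
    assume "card (?col c') \<le> card (?col c)"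
    then have "?col c' \<subseteq> ?col c"
      using chain[OF that] card_seteq[OF fincol, of "?col c" c'] by blast
    then show "\<forall>i. (i, c') \<in> B \<longrightarrow> (i, c) \<in> B" by auto
  qed
  have eq: "(\<forall>i. (i, c) \<in> B \<longleftrightarrow> (i, c') \<in> B) \<longleftrightarrow> card (?col c) = card (?col c')"
    if "c \<in> C n" "c' \<in> C n" for c c'
    using le[OF that] le[OF that(2,1)] by (metis order_antisym order_refl)
  have "{S \<in> Pow (C n). \<forall>c\<in>S. \<forall>c'\<in>C n - S. \<forall>i. (i, c') \<in> B \<longrightarrow> (i, c) \<in> B} =
    {S \<in> Pow (C n). \<forall>c\<in>S. \<forall>c'\<in>C n - S. card (?col c') \<le> card (?col c)}"
    using le by (intro Collect_cong conj_cong refl ball_cong) auto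
  moreover have "{K \<in> Pow (C n). \<forall>c\<in>K. \<forall>c'\<in>K. \<forall>i. (i, c) \<in> B \<longleftrightarrow> (i, c') \<in> B} =
    {K \<in> Pow (C n). \<forall>c\<in>K. \<forall>c'\<in>K. card (?col c) = card (?col c')}"
    using eq by (intro Collect_cong conj_cong refl ball_cong) auto
  ultimately show ?thesis
    using card_threshold_sets[OF fin, of "\<lambda>c. card (?col c)"] by simp
qed

text \<open>A filling whose columns in \<open>K\<close> agree is recovered from a single representative \<open>m\<close> of \<open>K\<close>
  by copying column \<open>m\<close>. A forbidden pattern after copying would give one before copying, with
  each column of \<open>K\<close> replaced by \<open>m\<close>.\<close>

lemma card_lonesum_equal_columns:
  assumes K: "\<And>i. i < n \<Longrightarrow> K \<subseteq> C i" and m: "m \<in> K"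
  shows "card {B \<in> Pow (Sigma {..<n} C). lonesum_set C B \<and>
        (\<forall>c\<in>K. \<forall>c'\<in>K. \<forall>i. (i, c) \<in> B \<longleftrightarrow> (i, c') \<in> B)} =
    card {B \<in> Pow (SIGMA i:{..<n}. C i - (K - {m})). lonesum_set (\<lambda>i. C i - (K - {m})) B}"
    (is "card ?E = card ?R")
proof (rule bij_betw_same_card)
  let ?p = "\<lambda>c. if c \<in> K then m else c"
  let ?del = "\<lambda>B. B \<inter> UNIV \<times> - (K - {m})"
  let ?copy = "\<lambda>B. {(i, c). (i, ?p c) \<in> B}"
  show "bij_betw ?del ?E ?R"
  proof (rule bij_betw_byWitness[where f' = ?copy])
    show "\<forall>B\<in>?E. ?copy (?del B) = B"
    proof
      fix B assume "B \<in> ?E"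
      then have "(i, m) \<in> B \<longleftrightarrow> (i, c) \<in> B" if "c \<in> K" for i c
        using that m by blast
      then show "?copy (?del B) = B" using m by (auto split: if_splits)
    qed
    show "\<forall>B\<in>?R. ?del (?copy B) = B"
      using m by (auto split: if_splits)
    show "?del ` ?E \<subseteq> ?R"
    proof (rule image_subsetI)
      fix B assume B: "B \<in> ?E"
      then have ls: "lonesum_set C B" by blast
      have "lonesum_set (\<lambda>i. C i - (K - {m})) (?del B)"
        unfolding lonesum_set_def
      proof (intro allI impI)
        fix r r' c c'
        assume h: "r' < r \<and> c' \<in> C r - (K - {m}) \<and> (r, c) \<in> ?del B \<and> (r, c') \<notin> ?del B
          \<and> (r', c') \<in> ?del B"
        then have "(r', c) \<in> B"
          by (intro ls[unfolded lonesum_set_def, rule_format, of r' r c' c]) auto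
        then show "(r', c) \<in> ?del B" using h by auto
      qed
      then show "?del B \<in> ?R" using B by auto
    qed
    show "?copy ` ?R \<subseteq> ?E"
    proof (rule image_subsetI)
      fix B assume B: "B \<in> ?R"
      then have ls: "lonesum_set (\<lambda>i. C i - (K - {m})) B" by blast
      have "lonesum_set C (?copy B)"
        unfolding lonesum_set_def
      proof (intro allI impI)
        fix r r' c c'
        assume h: "r' < r \<and> c' \<in> C r \<and> (r, c) \<in> ?copy B \<and> (r, c') \<notin> ?copy B
          \<and> (r', c') \<in> ?copy B"
        have "r < n" using h B by auto
        then have "?p c' \<in> C r - (K - {m})" using h K[of r] m by auto
        then have "(r', ?p c) \<in> B"
          using h by (intro ls[unfolded lonesum_set_def, rule_format, of r' r "?p c'" "?p c"]) auto
        then show "(r', c) \<in> ?copy B" by simp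
      qed
      moreover have "?copy B \<subseteq> Sigma {..<n} C"
      proof
        fix x assume "x \<in> ?copy B"
        then obtain i c where x: "x = (i, c)" "(i, ?p c) \<in> B" by auto
        then have "i < n" "?p c \<in> C i" using B by auto
        then show "x \<in> Sigma {..<n} C" using x(1) K[of i] by (auto split: if_splits)
      qed
      ultimately show "?copy B \<in> ?E" by auto
    qed
  qed
qed

lemma lonesum_recursion:
  assumes fin: "\<And>i. finite (C i)" and C: "antimono C"
  shows "card {A \<in> Pow (Sigma {..<Suc n} C). lonesum_set C A} =
    (\<Sum>K\<in>Pow (C n). card {B \<in> Pow (SIGMA i:{..<n}. C i - (K - {Max K})).
       lonesum_set (\<lambda>i. C i - (K - {Max K})) B})"
proof -
  let ?LS = "{B \<in> Pow (Sigma {..<n} C). lonesum_set C B}"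
  let ?top = "\<lambda>S B. \<forall>c\<in>S. \<forall>c'\<in>C n - S. \<forall>i. (i, c') \<in> B \<longrightarrow> (i, c) \<in> B"
  let ?equal = "\<lambda>K B. \<forall>c\<in>K. \<forall>c'\<in>K. \<forall>i. (i, c) \<in> B \<longleftrightarrow> (i, c') \<in> B"
  have finLS: "finite ?LS" and finP: "finite (Pow (C n))"
    using fin by auto
  have "card {A \<in> Pow (Sigma {..<Suc n} C). lonesum_set C A} =
    (\<Sum>S\<in>Pow (C n). card {B \<in> ?LS. ?top S B})"
    unfolding card_subsets_by_top_row[OF fin]
    using lonesum_set_add_top_row[of _ n C]
    by (intro sum.cong refl arg_cong[where f = card]) blast
  also have "\<dots> = (\<Sum>B\<in>?LS. card {S \<in> Pow (C n). ?top S B})"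
    by (rule card_filter_pairs_swap[OF finP finLS])
  also have "\<dots> = (\<Sum>B\<in>?LS. card {K \<in> Pow (C n). ?equal K B})"
    using card_admissible_top_rows[OF _ _ fin C] by (intro sum.cong refl) blast
  also have "\<dots> = (\<Sum>K\<in>Pow (C n). card {B \<in> ?LS. ?equal K B})"
    by (rule card_filter_pairs_swap[OF finP finLS, symmetric])
  also have "\<dots> = (\<Sum>K\<in>Pow (C n). card {B \<in> Pow (SIGMA i:{..<n}. C i - (K - {Max K})).
       lonesum_set (\<lambda>i. C i - (K - {Max K})) B})"
  proof (rule sum.cong[OF refl])
    fix K assume K: "K \<in> Pow (C n)"
    show "card {B \<in> ?LS. ?equal K B} = card {B \<in> Pow (SIGMA i:{..<n}. C i - (K - {Max K})).
       lonesum_set (\<lambda>i. C i - (K - {Max K})) B}"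
    proof (cases "K = {}")
      case True
      then show ?thesis by simp
    next
      case False
      have "finite K" using K fin finite_subset by auto
      then have "Max K \<in> K" using False by simp
      moreover have "K \<subseteq> C i" if "i < n" for i
        using K that C[THEN antimonoD, of i n] by auto
      ultimately show ?thesis
        using card_lonesum_equal_columns[of n K C "Max K"] by simp
    qed
  qed
  finally show ?thesis .
qed

section \<open>Equality of the two counts\<close>

lemma card_gamma_free_set_eq_card_lonesum_set:
  assumes "\<And>i. finite (C i)" "antimono C"
  shows "card {A \<in> Pow (Sigma {..<n} C). gamma_free_set A} =
    card {A \<in> Pow (Sigma {..<n} C). lonesum_set C A}"
  using assms
proof (induction n arbitrary: C)
  case 0
  have "{A \<in> Pow (Sigma {..<0} C). gamma_free_set A} = {A \<in> Pow (Sigma {..<0} C). lonesum_set C A}"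
    by (auto simp: gamma_free_set_def lonesum_set_def)
  then show ?case by (rule arg_cong)
next
  case (Suc n)
  have "antimono (\<lambda>i. C i - D)" for D
    using Suc.prems(2) by (auto simp: antimono_def)
  then have "card {A \<in> Pow (SIGMA i:{..<n}. C i - D). gamma_free_set A} =
      card {A \<in> Pow (SIGMA i:{..<n}. C i - D). lonesum_set (\<lambda>i. C i - D) A}" for D
    using Suc.prems(1) by (intro Suc.IH) auto
  then show ?case
    unfolding gamma_recursion[OF Suc.prems(1)] lonesum_recursion[OF Suc.prems] by simp
qed

theorem theorem3:
  fixes lam :: "nat list"
  assumes "is_partition lam"
  shows "card {f \<in> fillings (ferrers_shape lam). gamma_free (ferrers_shape lam) f} =
         card {f \<in> fillings (ferrers_shape lam). lonesum (ferrers_shape lam) f}"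
proof -
  \<comment> \<open>Row indices beyond the shape get no columns, which keeps \<open>C\<close> decreasing on all naturals.\<close>
  define C where "C i = (if i < length lam then {..<lam ! i} else {})" for i
  have F: "ferrers_shape lam = Sigma {..<length lam} C"
    by (auto simp: ferrers_shape_def C_def)
  have fin: "finite (C i)" for i by (simp add: C_def)
  have "lam ! j \<le> lam ! i" if "i \<le> j" "j < length lam" for i j
    using assms that by (cases "i = j") (auto simp: is_partition_def sorted_wrt_iff_nth_less)
  then have C: "antimono C"
    by (fastforce simp: antimono_def C_def)
  have "card {f \<in> fillings (ferrers_shape lam). gamma_free (ferrers_shape lam) f} =
      card {A \<in> Pow (Sigma {..<length lam} C). gamma_free_set A}"
    unfolding F by (intro card_fillings_eq_card_subsets gamma_free_iff_gamma_free_set)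
  also have "\<dots> = card {A \<in> Pow (Sigma {..<length lam} C). lonesum_set C A}"
    by (rule card_gamma_free_set_eq_card_lonesum_set[OF fin C])
  also have "\<dots> = card {f \<in> fillings (ferrers_shape lam). lonesum (ferrers_shape lam) f}"
    unfolding F by (intro card_fillings_eq_card_subsets[symmetric] lonesum_iff_lonesum_set C)
  finally show ?thesis .
qed

end
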